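(* The generating function $\sum_P z^{\mathrm{area}(P)}$, summed over all Stanley polyominoes $P$, equals \[ \frac{\displaystyle\sum_{\ell\ge 0}\frac{(-1)^{\ell}z^{\frac{(\ell+2)(\ell+1)}{2}}}{(z,z)_\ell^2\left(1-z^{\ell+1}\right)}}{\displaystyle 1-\sum_{\ell\geq 0}\frac{(-1)^{\ell}z^{\frac{(\ell+4)(\ell+1)}{2}}}{(z,z)_{\ell+1}^2}}. \]
   Context: Cells are unit squares $[i,i+1]\times[j,j+1]$ with $i,j\in\mathbb{Z}$. A Stanley polyomino (up to translation) is a set of cells forming $k\geq 1$ rows $0,\dots,k-1$ (bottom to top), row $j$ consisting of the cells with $s_j\le i\le e_j$ ($s_j\le e_j$ integers), such that $s_{j-1}<s_j\le e_{j-1}<e_j$ for $1\le j\le k-1$. $\mathrm{area}(P)$ is the number of cells. The Pochhammer symbol is $(a,b)_k=\prod_{j=0}^{k-1}(1-ab^j)$. *)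

theory Defs
  imports "HOL-Analysis.Analysis" "HOL-Computational_Algebra.Formal_Power_Series"
begin

text \<open>The pair \<open>(i, j)\<close> stands for the unit square \<open>[i, i+1] \<times> [j, j+1]\<close>.\<close>

type_synonym cell = "int \<times> int"

definition stanley_cells :: "nat \<Rightarrow> (nat \<Rightarrow> int) \<Rightarrow> (nat \<Rightarrow> int) \<Rightarrow> cell set" where
  "stanley_cells k s e = {(i, int j) | i j. j < k \<and> s j \<le> i \<and> i \<le> e j}"

definition is_stanley :: "cell set \<Rightarrow> bool" where
  "is_stanley P \<longleftrightarrow> (\<exists>k s e. 1 \<le> k \<and>
     (\<forall>j<k. s j \<le> e j) \<and>
     (\<forall>j. 1 \<le> j \<and> j < k \<longrightarrow>
        s (j - 1) < s j \<and> s j \<le> e (j - 1) \<and> e (j - 1) < e j) \<and>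
     P = stanley_cells k s e)"

definition translate :: "cell \<Rightarrow> cell set \<Rightarrow> cell set" where
  "translate v P = (\<lambda>c. c + v) ` P"

definition translation_rel :: "(cell set \<times> cell set) set" where
  "translation_rel =
     {(P, Q). is_stanley P \<and> is_stanley Q \<and> (\<exists>v. Q = translate v P)}"

text \<open>Since \<^const>\<open>is_stanley\<close> already puts the bottom row at height 0, only horizontal
  translations are effective here.\<close>

definition stanley_polyominoes :: "cell set set set" where
  "stanley_polyominoes = {P. is_stanley P} // translation_rel"

text \<open>The area of a translation class is the number of cells of any representative; it is
  well defined by \<open>area_class\<close> below.\<close>

definition area :: "cell set set \<Rightarrow> nat" where
  "area C = the_elem (card ` C)"

definition q_pochhammer :: "'a::comm_ring_1 \<Rightarrow> 'a \<Rightarrow> nat \<Rightarrow> 'a" where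
  "q_pochhammer a b k = (\<Prod>j<k. 1 - a * b ^ j)"

lemma card_translate: "card (translate v P) = card P"
  unfolding translate_def by (rule card_image) (auto simp: inj_on_def)

lemma equiv_translation_rel: "equiv {P. is_stanley P} translation_rel"
proof (rule equivI)
  show "translation_rel \<subseteq> {P. is_stanley P} \<times> {P. is_stanley P}"
    by (auto simp: translation_rel_def)
  have id: "\<exists>v. P = translate v P" for P
    by (rule exI[of _ 0]) (simp add: translate_def)
  show "refl_on {P. is_stanley P} translation_rel"
    using id by (simp add: refl_on_def translation_rel_def)
  have "P = translate (- v) (translate v P)" for v P
    by (simp add: translate_def image_image)
  then show "sym translation_rel"
    unfolding sym_def translation_rel_def by blast
  have "translate w (translate v P) = translate (v + w) P" for v w P
    by (simp add: translate_def image_image add.assoc)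
  then show "trans translation_rel"
    unfolding trans_def translation_rel_def by blast
qed

lemma area_class:
  assumes "is_stanley P"
  shows "area (translation_rel `` {P}) = card P"
proof -
  have "P \<in> translation_rel `` {P}"
    using equiv_class_self[OF equiv_translation_rel] assms by simp
  then have "card ` (translation_rel `` {P}) = {card P}"
    by (auto simp: translation_rel_def card_translate)
  then show ?thesis
    by (simp add: area_def)
qed

end

theory Submission
  imports Defs
begin

text \<open>
  Adding a row on top of a row of \<open>a\<close> cells leaves \<open>min a b - 1\<close> positions for a new row of
  \<open>b\<close> cells. Let \<open>F i\<close> (\<open>rows_gf i\<close> below) be the generating function in which the top row, of \<open>a\<close> cells, receives
  the additional weight \<open>X ^ (i * a)\<close>. Removing the top row gives, with \<open>y = X ^ (i + 1)\<close>,
  \<open>F i = y / (1 - y) + (y\<^sup>2 * F 0 - y * F (i + 1)) / (1 - y)\<^sup>2\<close>.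
  Iterating from \<open>i = 0\<close> pushes the unknown \<open>F N\<close> into arbitrarily high order and leaves a linear
  equation for \<open>F 0\<close>.
\<close>

unbundle no vec_syntax
unbundle fps_syntax

section \<open>Generating functions of weighted sets\<close>

text \<open>The cardinality of an infinite set is 0, so \<open>gf\<close> counts as intended only
  when all fibres are finite.\<close>

definition finite_fibres :: "'a set \<Rightarrow> ('a \<Rightarrow> nat) \<Rightarrow> bool" where
  "finite_fibres A w \<longleftrightarrow> (\<forall>n. finite {x\<in>A. w x = n})"

definition gf :: "'a set \<Rightarrow> ('a \<Rightarrow> nat) \<Rightarrow> rat fps" where
  "gf A w = Abs_fps (\<lambda>n. of_nat (card {x\<in>A. w x = n}))"

lemma finite_fibres_mono:
  assumes "finite_fibres B w" "A \<subseteq> B"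
  shows "finite_fibres A w"
  unfolding finite_fibres_def
proof
  fix n
  show "finite {x\<in>A. w x = n}"
    by (rule finite_subset[of _ "{x\<in>B. w x = n}"])
       (use assms in \<open>auto simp: finite_fibres_def\<close>)
qed

lemma finite_fibres_le:
  assumes "finite_fibres A w" "\<And>x. x \<in> A \<Longrightarrow> w x \<le> v x"
  shows "finite_fibres A v"
  unfolding finite_fibres_def
proof
  fix n
  have "{x\<in>A. v x = n} \<subseteq> (\<Union>m\<le>n. {x\<in>A. w x = m})"
    using assms(2) by auto
  then show "finite {x\<in>A. v x = n}"
    by (rule finite_subset) (use assms(1) in \<open>auto simp: finite_fibres_def\<close>)
qed

text \<open>The union over the weight \<open>k\<close> of the first component is disjoint; counting
  it gives the Cauchy product in \<open>gf_Times\<close>.\<close>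

lemma fibre_Times:
  "{x\<in>A \<times> B. (case x of (a, b) \<Rightarrow> w a + v b) = n} =
     (\<Union>k\<le>n. {a\<in>A. w a = k} \<times> {b\<in>B. v b = n - k})"
  for w v :: "_ \<Rightarrow> nat"
  by auto

lemma finite_fibres_Times:
  assumes "finite_fibres A w" "finite_fibres B v"
  shows "finite_fibres (A \<times> B) (\<lambda>(a, b). w a + v b)"
  using assms unfolding finite_fibres_def fibre_Times by auto

lemma gf_Times:
  assumes "finite_fibres A w" "finite_fibres B v"
  shows "gf (A \<times> B) (\<lambda>(a, b). w a + v b) = gf A w * gf B v"
proof (rule fps_ext)
  fix n
  have "card {x\<in>A \<times> B. (case x of (a, b) \<Rightarrow> w a + v b) = n} =
      (\<Sum>k\<le>n. card ({a\<in>A. w a = k} \<times> {b\<in>B. v b = n - k}))"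
    unfolding fibre_Times
    by (rule card_UN_disjoint) (use assms in \<open>auto simp: finite_fibres_def\<close>)
  then show "gf (A \<times> B) (\<lambda>(a, b). w a + v b) $ n = (gf A w * gf B v) $ n"
    by (simp add: gf_def fps_mult_nth card_cartesian_product atLeast0AtMost)
qed

lemma gf_Un_disjoint:
  assumes "finite_fibres (A \<union> B) w" "A \<inter> B = {}"
  shows "gf (A \<union> B) w = gf A w + gf B w"
proof (rule fps_ext)
  fix n
  have "{x\<in>A \<union> B. w x = n} = {x\<in>A. w x = n} \<union> {x\<in>B. w x = n}"
    by auto
  moreover have "finite {x\<in>A. w x = n}" "finite {x\<in>B. w x = n}"
    using assms(1) finite_fibres_mono[of "A \<union> B" w] by (auto simp: finite_fibres_def)
  ultimately have "card {x\<in>A \<union> B. w x = n} = card {x\<in>A. w x = n} + card {x\<in>B. w x = n}"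
    using assms(2) by (subst card_Un_disjoint[symmetric]) auto
  then show "gf (A \<union> B) w $ n = (gf A w + gf B w) $ n"
    by (simp add: gf_def)
qed

lemma gf_bij_betw:
  assumes "bij_betw h A B" "\<And>x. x \<in> A \<Longrightarrow> v (h x) = w x"
  shows "gf A w = gf B v"
proof (rule fps_ext)
  fix n
  have "bij_betw h {x\<in>A. w x = n} {y\<in>B. v y = n}"
    using assms unfolding bij_betw_def inj_on_def by auto
  then show "gf A w $ n = gf B v $ n"
    by (simp add: gf_def bij_betw_same_card)
qed

lemma gf_cong: "(\<And>x. x \<in> A \<Longrightarrow> v x = w x) \<Longrightarrow> gf A v = gf A w"
  by (rule gf_bij_betw[of id]) auto

lemma gf_shift: "gf A (\<lambda>x. w x + c) = fps_X ^ c * gf A w"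
proof (rule fps_ext)
  fix n
  have "{x\<in>A. w x + c = n} = (if n < c then {} else {x\<in>A. w x = n - c})"
    by auto
  then show "gf A (\<lambda>x. w x + c) $ n = (fps_X ^ c * gf A w) $ n"
    by (simp add: gf_def fps_X_power_mult_nth)
qed

text \<open>Only the finitely many elements of weight \<open>n\<close> contribute to coefficient
  \<open>n\<close>, which is what summability of formal power series asks for. This turns the
  counting series into the sum over polyominoes.\<close>

lemma has_sum_gf:
  assumes "finite_fibres A w"
  shows "((\<lambda>x. fps_X ^ w x) has_sum gf A w) A"
proof (rule has_sum_fpsI)
  fix n
  have eq: "{x\<in>A. (fps_X ^ w x :: rat fps) $ n \<noteq> 0} = {x\<in>A. w x = n}"
    by auto
  show "finite {x\<in>A. (fps_X ^ w x :: rat fps) $ n \<noteq> 0}"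
    unfolding eq using assms by (auto simp: finite_fibres_def)
  show "gf A w $ n = (\<Sum>x | x \<in> A \<and> (fps_X ^ w x :: rat fps) $ n \<noteq> 0. (fps_X ^ w x) $ n)"
    unfolding eq by (simp add: gf_def)
qed

lemma finite_fibres_multiples: "0 < c \<Longrightarrow> finite_fibres (UNIV :: nat set) ((*) c)"
  by (rule finite_fibres_le[of _ id]) (auto simp: finite_fibres_def)

lemma gf_multiples:
  assumes "0 < c"
  shows "gf (UNIV :: nat set) ((*) c) = inverse (1 - fps_X ^ c)"
proof -
  let ?g = "gf (UNIV :: nat set) ((*) c)"
  \<comment> \<open>Splitting the naturals into 0 and the successors yields the equation
    \<open>?g = 1 + fps_X ^ c * ?g\<close> of the geometric series.\<close>
  have "gf (range Suc) ((*) c) = gf UNIV (\<lambda>n. c * n + c)"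
    by (rule gf_bij_betw[of Suc, symmetric]) (auto simp: bij_betw_def)
  moreover have "gf {0} ((*) c) = 1"
    by (rule fps_ext) (auto simp: gf_def card_eq_0_iff Collect_conv_if)
  ultimately have "?g = 1 + fps_X ^ c * ?g"
    using gf_Un_disjoint[of "{0}" "range Suc" "(*) c"] finite_fibres_multiples[OF assms]
    by (simp add: UNIV_nat_eq[symmetric] gf_shift)
  then have "?g * (1 - fps_X ^ c) = 1"
    by (simp add: algebra_simps)
  then show ?thesis
    by (metis fps_inverse_unique mult.commute)
qed


section \<open>Lists of rows\<close>

text \<open>A row \<open>(s, n)\<close> stands for the \<open>n + 1\<close> cells from \<open>s\<close> to \<open>s + n\<close>.\<close>

definition row_step :: "nat \<times> nat \<Rightarrow> nat \<times> nat \<Rightarrow> bool" where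
  "row_step = (\<lambda>(s, n) (s', n'). s < s' \<and> s' \<le> s + n \<and> s + n < s' + n')"

text \<open>Rows are listed from bottom to top. Starting the first one at 0 selects one member of
  each translation class, and natural coordinates suffice because left ends increase.\<close>

definition row_lists :: "(nat \<times> nat) list set" where
  "row_lists = {xs. xs \<noteq> [] \<and> fst (hd xs) = 0 \<and> successively row_step xs}"

definition rows_area :: "(nat \<times> nat) list \<Rightarrow> nat" where
  "rows_area xs = (\<Sum>x\<leftarrow>xs. snd x + 1)"

lemma rows_area_snoc [simp]: "rows_area (xs @ [x]) = rows_area xs + snd x + 1"
  by (simp add: rows_area_def)

lemma snoc_in_row_lists:
  "xs @ [x] \<in> row_lists \<longleftrightarrow>
     (if xs = [] then fst x = 0 else xs \<in> row_lists \<and> row_step (last xs) x)"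
  by (auto simp: row_lists_def successively_append_iff)

lemma Nil_notin_row_lists [simp]: "[] \<notin> row_lists"
  by (simp add: row_lists_def)

text \<open>A new row starts no further right than the last cell below it, so the right end grows by
  less than the number of added cells. Hence the area bounds the length and all entries, which
  leaves finitely many lists of each area.\<close>

lemma row_lists_bound:
  assumes "xs \<in> row_lists"
  shows "fst (last xs) + snd (last xs) < rows_area xs \<and> length xs \<le> rows_area xs \<and>
    set xs \<subseteq> {..<rows_area xs} \<times> {..<rows_area xs}"
  using assms
proof (induction xs rule: rev_induct)
  case Nil
  then show ?case by (simp add: row_lists_def)
next
  case (snoc x xs)
  show ?case
  proof (cases "xs = []")
    case True
    then show ?thesis
      using snoc.prems by (cases x) (auto simp: row_lists_def rows_area_def)
  next
    case False
    with snoc show ?thesis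
      by (cases x; cases "last xs") (auto simp: snoc_in_row_lists row_step_def)
  qed
qed

lemma finite_fibres_row_lists: "finite_fibres row_lists rows_area"
  unfolding finite_fibres_def
proof
  fix n
  have "{xs\<in>row_lists. rows_area xs = n} \<subseteq>
      {xs. set xs \<subseteq> {..<n} \<times> {..<n} \<and> length xs \<le> n}"
    using row_lists_bound by auto
  then show "finite {xs\<in>row_lists. rows_area xs = n}"
    by (rule finite_subset) (intro finite_lists_length_le finite_cartesian_product; simp)
qed

section \<open>Adding a row on top\<close>

definition extensions :: "((nat \<times> nat) list \<times> nat \<times> nat) set" where
  "extensions = {(xs, d, p). xs \<in> row_lists \<and> d < snd (last xs)}"

text \<open>The new row overlaps the last one in \<open>d + 1\<close> cells and sticks out by \<open>p + 1\<close> cells.\<close>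

definition extend :: "(nat \<times> nat) list \<times> nat \<times> nat \<Rightarrow> (nat \<times> nat) list" where
  "extend = (\<lambda>(xs, d, p). xs @ [(fst (last xs) + snd (last xs) - d, d + 1 + p)])"

text \<open>In the parameters \<open>d\<close> and \<open>p\<close>, the overlap condition and the
  condition on right ends hold automatically; the increase of left ends becomes
  \<open>d < snd (last xs)\<close>. Thus \<open>p\<close> is free.\<close>

lemma bij_betw_extend: "bij_betw extend extensions {ys\<in>row_lists. length ys \<noteq> 1}"
proof -
  let ?g = "\<lambda>ys. let xs = butlast ys; (s, n) = last xs; (s', n') = last ys
              in (xs, s + n - s', s' + n' - (s + n) - 1)"
  show ?thesis
  proof (rule bij_betw_byWitness[of _ ?g])
    show "\<forall>a\<in>extensions. ?g (extend a) = a"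
      by (auto simp: extensions_def extend_def split: prod.splits)
    show "\<forall>ys\<in>{ys\<in>row_lists. length ys \<noteq> 1}. extend (?g ys) = ys"
    proof
      fix ys assume ys: "ys \<in> {ys\<in>row_lists. length ys \<noteq> 1}"
      then obtain xs x where "ys = xs @ [x]"
        by (cases ys rule: rev_cases) (auto simp: row_lists_def)
      with ys show "extend (?g ys) = ys"
        by (cases x; cases "last xs")
           (auto simp: snoc_in_row_lists row_step_def extend_def split: if_splits)
    qed
    show "extend ` extensions \<subseteq> {ys\<in>row_lists. length ys \<noteq> 1}"
      by (auto simp: extensions_def extend_def snoc_in_row_lists row_step_def split: prod.splits)
    show "?g ` {ys\<in>row_lists. length ys \<noteq> 1} \<subseteq> extensions"
    proof
      fix a assume "a \<in> ?g ` {ys\<in>row_lists. length ys \<noteq> 1}"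
      then obtain ys where ys: "ys \<in> row_lists" "length ys \<noteq> 1" "a = ?g ys"
        by blast
      then obtain xs x where "ys = xs @ [x]"
        by (cases ys rule: rev_cases) (auto simp: row_lists_def)
      with ys show "a \<in> extensions"
        by (cases x; cases "last xs")
           (auto simp: snoc_in_row_lists row_step_def extensions_def split: if_splits)
    qed
  qed
qed

section \<open>The functional equation\<close>

definition rows_gf :: "nat \<Rightarrow> rat fps" where
  "rows_gf i = gf row_lists (\<lambda>xs. rows_area xs + i * (snd (last xs) + 1))"

lemma finite_fibres_rows_weight:
  "finite_fibres row_lists (\<lambda>xs. rows_area xs + i * (snd (last xs) + 1))"
  by (rule finite_fibres_le[OF finite_fibres_row_lists]) simp

text \<open>Each cell of a single row counts once for the area and \<open>i\<close> times for the
  extra weight, hence \<open>c = i + 1\<close> in total. Summing over the row lengths is a geometric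
  series.\<close>

lemma rows_gf_single:
  fixes i :: nat
  defines "c \<equiv> Suc i"
  shows "gf {xs\<in>row_lists. length xs = 1} (\<lambda>xs. rows_area xs + i * (snd (last xs) + 1)) =
    fps_X ^ c * inverse (1 - fps_X ^ c)"
proof -
  have "bij_betw (\<lambda>n. [(0, n)]) UNIV {xs\<in>row_lists. length xs = 1}"
    by (rule bij_betw_byWitness[of _ "\<lambda>xs. snd (hd xs)"])
       (auto simp: row_lists_def length_Suc_conv)
  then have "gf {xs\<in>row_lists. length xs = 1} (\<lambda>xs. rows_area xs + i * (snd (last xs) + 1)) =
      gf UNIV (\<lambda>n. c * n + c)"
    by (rule gf_bij_betw[symmetric]) (simp add: rows_area_def c_def algebra_simps)
  also have "\<dots> = fps_X ^ c * inverse (1 - fps_X ^ c)"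
    unfolding gf_shift by (subst gf_multiples) (simp_all add: c_def)
  finally show ?thesis .
qed

text \<open>Without the restriction \<open>d < snd (last xs)\<close> the extension data form a product. In the
  complement, subtracting \<open>snd (last xs)\<close> from \<open>d\<close> gives a product again.\<close>

lemma rows_gf_extensions:
  fixes i :: nat
  defines "c \<equiv> Suc i"
  shows "gf extensions (\<lambda>(xs, d, p). rows_area xs + c * (d + p + 2)) =
    (fps_X ^ (2 * c) * rows_gf 0 - fps_X ^ c * rows_gf c) * (inverse (1 - fps_X ^ c))\<^sup>2"
proof -
  define w where "w = (\<lambda>(xs, d, p). rows_area xs + c * (d + p + 2))"
  define N where "N = {(xs, d, p :: nat). xs \<in> row_lists \<and> snd (last xs) \<le> d}"
  have c: "0 < c" by (simp add: c_def)
  note fin = finite_fibres_multiples[OF c]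
  have fin2: "finite_fibres (UNIV :: (nat \<times> nat) set) (\<lambda>(d, p). c * d + c * p)"
    using finite_fibres_Times[OF fin fin] by simp
  have gf2: "gf (UNIV :: (nat \<times> nat) set) (\<lambda>(d, p). c * d + c * p) =
      (inverse (1 - fps_X ^ c))\<^sup>2"
    using gf_Times[OF fin fin] by (simp add: gf_multiples[OF c] power2_eq_square)
  have un: "row_lists \<times> UNIV = extensions \<union> N"
    by (auto simp: extensions_def N_def)
  have "finite_fibres (row_lists \<times> UNIV) w"
    by (rule finite_fibres_le[OF finite_fibres_Times[OF finite_fibres_row_lists fin2]])
       (auto simp: w_def algebra_simps)
  then have sum: "gf (row_lists \<times> UNIV) w = gf extensions w + gf N w"
    unfolding un by (rule gf_Un_disjoint) (auto simp: extensions_def N_def)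
  \<comment> \<open>The new row has \<open>d + p + 2\<close> cells; its two obligatory cells give
    the shift by \<open>2 * c\<close>.\<close>
  have "gf (row_lists \<times> UNIV) w =
      gf (row_lists \<times> UNIV)
        (\<lambda>x. (case x of (xs, d, p) \<Rightarrow> rows_area xs + (c * d + c * p)) + 2 * c)"
    by (rule gf_cong) (auto simp: w_def algebra_simps)
  also have "\<dots> = fps_X ^ (2 * c) * rows_gf 0 * (inverse (1 - fps_X ^ c))\<^sup>2"
    using gf_Times[OF finite_fibres_row_lists fin2]
    by (simp add: gf_shift gf2[unfolded case_prod_unfold] rows_gf_def case_prod_unfold mult.assoc)
  finally have total:
    "gf (row_lists \<times> UNIV) w = fps_X ^ (2 * c) * rows_gf 0 * (inverse (1 - fps_X ^ c))\<^sup>2" .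
  have bij: "bij_betw (\<lambda>(xs, d, p). (xs, snd (last xs) + d, p)) (row_lists \<times> UNIV) N"
    by (rule bij_betw_byWitness[of _ "\<lambda>(xs, d, p). (xs, d - snd (last xs), p)"])
       (auto simp: N_def)
  \<comment> \<open>Once \<open>d\<close> exceeds \<open>snd (last xs)\<close>, the new row contains
    as many cells as the old top row and more. These carry weight \<open>c\<close> each and turn
    into an extra weight on the old top row, so \<open>rows_gf c\<close> appears and only one
    \<open>c\<close> remains as a shift.\<close>
  have "gf N w = gf (row_lists \<times> UNIV)
        (\<lambda>x. (case x of (xs, d, p) \<Rightarrow>
           rows_area xs + c * (snd (last xs) + 1) + (c * d + c * p)) + c)"
    by (rule gf_bij_betw[OF bij, symmetric]) (auto simp: w_def algebra_simps)
  also have "\<dots> = fps_X ^ c * rows_gf c * (inverse (1 - fps_X ^ c))\<^sup>2"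
    using gf_Times[OF finite_fibres_rows_weight fin2]
    by (simp add: gf_shift gf2[unfolded case_prod_unfold] rows_gf_def case_prod_unfold mult.assoc)
  finally show ?thesis
    using sum total by (simp add: w_def algebra_simps)
qed

lemma rows_gf_rec:
  fixes i :: nat
  defines "c \<equiv> Suc i"
  shows "rows_gf i = fps_X ^ c * inverse (1 - fps_X ^ c) +
    (fps_X ^ (2 * c) * rows_gf 0 - fps_X ^ c * rows_gf c) * (inverse (1 - fps_X ^ c))\<^sup>2"
proof -
  let ?w = "\<lambda>xs. rows_area xs + i * (snd (last xs) + 1)"
  have un: "row_lists = {xs\<in>row_lists. length xs = 1} \<union> {xs\<in>row_lists. length xs \<noteq> 1}"
    by auto
  have "rows_gf i = gf {xs\<in>row_lists. length xs = 1} ?w + gf {xs\<in>row_lists. length xs \<noteq> 1} ?w"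
    unfolding rows_gf_def
    by (subst un, rule gf_Un_disjoint) (use finite_fibres_rows_weight un in auto)
  \<comment> \<open>The top row is now the added one, so each of its \<open>d + p + 2\<close> cells
    has weight \<open>i + 1\<close>.\<close>
  also have "gf {xs\<in>row_lists. length xs \<noteq> 1} ?w =
      gf extensions (\<lambda>(xs, d, p). rows_area xs + c * (d + p + 2))"
    by (rule gf_bij_betw[OF bij_betw_extend, symmetric])
       (auto simp: extend_def c_def algebra_simps)
  finally show ?thesis
    unfolding c_def rows_gf_single rows_gf_extensions .
qed


section \<open>Stanley polyominoes as lists of rows\<close>

definition cells :: "(nat \<times> nat) list \<Rightarrow> cell set" where
  "cells xs = stanley_cells (length xs) (\<lambda>j. int (fst (xs ! j)))
     (\<lambda>j. int (fst (xs ! j) + snd (xs ! j)))"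

lemma mem_cells:
  "(x, y) \<in> cells xs \<longleftrightarrow> (\<exists>j<length xs. y = int j \<and> int (fst (xs ! j)) \<le> x \<and>
     x \<le> int (fst (xs ! j) + snd (xs ! j)))"
  by (auto simp: cells_def stanley_cells_def)

lemma is_stanley_cells:
  assumes "xs \<in> row_lists"
  shows "is_stanley (cells xs)"
proof -
  let ?s = "\<lambda>j. int (fst (xs ! j))" and ?e = "\<lambda>j. int (fst (xs ! j) + snd (xs ! j))"
  have "?s (j - 1) < ?s j \<and> ?s j \<le> ?e (j - 1) \<and> ?e (j - 1) < ?e j"
    if "1 \<le> j" "j < length xs" for j
  proof -
    have "row_step (xs ! (j - 1)) (xs ! j)"
      using assms that by (cases j) (auto simp: row_lists_def successively_conv_nth)
    then show ?thesis
      by (auto simp: row_step_def split: prod.splits)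
  qed
  moreover have "1 \<le> length xs"
    using assms by (cases xs) auto
  moreover have "\<forall>j<length xs. ?s j \<le> ?e j"
    by simp
  ultimately show ?thesis
    unfolding is_stanley_def
    by (intro exI[of _ "length xs"] exI[of _ ?s] exI[of _ ?e]) (simp add: cells_def)
qed

lemma card_cells: "card (cells xs) = rows_area xs"
proof -
  let ?S = "SIGMA j:{..<length xs}. {int (fst (xs ! j))..int (fst (xs ! j) + snd (xs ! j))}"
  have "cells xs = (\<lambda>(j, x). (x, int j)) ` ?S"
    by (auto simp: cells_def stanley_cells_def image_iff)
  also have "card \<dots> = card ?S"
    by (rule card_image) (auto simp: inj_on_def)
  also have "\<dots> = (\<Sum>j<length xs. snd (xs ! j) + 1)"
    by (subst card_SigmaI) (auto intro!: sum.cong)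
  also have "\<dots> = rows_area xs"
    by (simp add: rows_area_def sum_list_sum_nth atLeast0LessThan)
  finally show ?thesis .
qed

text \<open>Every row is nonempty, and its two end cells must lie in the row of \<open>ys\<close> at
  the same height. Inclusions both ways then force equality in \<open>inj_cells\<close>.\<close>

lemma cells_subset_imp:
  assumes "cells xs \<subseteq> cells ys"
  shows "length xs \<le> length ys"
    and "j < length xs \<Longrightarrow> fst (ys ! j) \<le> fst (xs ! j)"
    and "j < length xs \<Longrightarrow> fst (xs ! j) + snd (xs ! j) \<le> fst (ys ! j) + snd (ys ! j)"
proof -
  have row: "j < length ys \<and> fst (ys ! j) \<le> fst (xs ! j) \<and>
      fst (xs ! j) + snd (xs ! j) \<le> fst (ys ! j) + snd (ys ! j)" if "j < length xs" for j
  proof -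
    have "(int (fst (xs ! j)), int j) \<in> cells xs"
      "(int (fst (xs ! j) + snd (xs ! j)), int j) \<in> cells xs"
      using that unfolding mem_cells by auto
    with assms have "(int (fst (xs ! j)), int j) \<in> cells ys"
      "(int (fst (xs ! j) + snd (xs ! j)), int j) \<in> cells ys"
      by auto
    then show ?thesis
      by (auto simp: mem_cells)
  qed
  \<comment> \<open>Otherwise \<open>row\<close> applied to the index \<open>length ys\<close> would
    give \<open>length ys < length ys\<close>.\<close>
  show "length xs \<le> length ys"
    using row by (meson not_le_imp_less order_less_irrefl)
  show "j < length xs \<Longrightarrow> fst (ys ! j) \<le> fst (xs ! j)"
    and "j < length xs \<Longrightarrow> fst (xs ! j) + snd (xs ! j) \<le> fst (ys ! j) + snd (ys ! j)"
    using row by auto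
qed

lemma inj_cells: "inj cells"
proof (rule injI)
  fix xs ys assume "cells xs = cells ys"
  then have "cells xs \<subseteq> cells ys" "cells ys \<subseteq> cells xs" by auto
  note sub = cells_subset_imp[OF this(1)] cells_subset_imp[OF this(2)]
  have "length xs = length ys"
    using sub by (intro antisym)
  moreover have "xs ! j = ys ! j" if "j < length xs" for j
    using sub(2,3,5,6)[of j] that \<open>length xs = length ys\<close> by (intro prod_eqI) auto
  ultimately show "xs = ys"
    by (intro nth_equalityI)
qed

text \<open>Both polyominoes lie in the positive quadrant and contain the origin, so neither \<open>v\<close>
  nor \<open>- v\<close> can have a negative coordinate.\<close>

lemma translate_cells_imp_zero:
  assumes "xs \<in> row_lists" "ys \<in> row_lists" "cells ys = translate v (cells xs)"
  shows "v = 0"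
proof -
  have origin: "(0, 0) \<in> cells zs" if "zs \<in> row_lists" for zs
    using that unfolding mem_cells by (auto simp: row_lists_def hd_conv_nth)
  have nonneg: "0 \<le> fst c \<and> 0 \<le> snd c" if "c \<in> cells zs" for c zs
    using that by (cases c) (auto simp: mem_cells)
  have "v \<in> cells ys"
    using origin[OF assms(1)] assms(3) by (force simp: translate_def zero_prod_def)
  moreover obtain c where "c \<in> cells xs" "c + v = (0, 0)"
    using origin[OF assms(2)] assms(3) by (auto simp: translate_def)
  ultimately show ?thesis
    using nonneg[of v ys] nonneg[of c xs]
    by (cases c; cases v) (auto simp: zero_prod_def)
qed

lemma stanley_normal_form:
  assumes "is_stanley P"
  obtains xs v where "xs \<in> row_lists" "cells xs = translate v P"
proof -
  from assms obtain k s e where k: "1 \<le> k" and row: "\<And>j. j < k \<Longrightarrow> s j \<le> e j"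
    and step: "\<And>j. 1 \<le> j \<Longrightarrow> j < k \<Longrightarrow>
      s (j - 1) < s j \<and> s j \<le> e (j - 1) \<and> e (j - 1) < e j"
    and P: "P = stanley_cells k s e"
    unfolding is_stanley_def by blast
  have mono: "s 0 \<le> s j" if "j < k" for j
    using that
  proof (induction j)
    case (Suc j)
    then show ?case using step[of "Suc j"] by simp
  qed simp
  \<comment> \<open>By \<open>mono\<close> and \<open>row\<close> both differences are nonnegative,
    so \<open>nat\<close> loses nothing.\<close>
  define xs where "xs = map (\<lambda>j. (nat (s j - s 0), nat (e j - s j))) [0..<k]"
  have len: "length xs = k"
    by (simp add: xs_def)
  have nth: "int (fst (xs ! j)) = s j - s 0" "int (snd (xs ! j)) = e j - s j" if "j < k" for j
    using that mono[OF that] row[OF that] by (auto simp: xs_def)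
  have "row_step (xs ! j) (xs ! Suc j)" if "Suc j < k" for j
    using step[of "Suc j"] nth[of j] nth[of "Suc j"] that
    by (auto simp: row_step_def split: prod.splits)
  moreover have "fst (hd xs) = 0" "xs \<noteq> []"
    using k by (auto simp: xs_def hd_map)
  ultimately have "xs \<in> row_lists"
    by (simp add: row_lists_def successively_conv_nth len)
  moreover have "cells xs = translate (- s 0, 0) P"
  proof (rule set_eqI)
    fix c :: cell
    obtain x y where c: "c = (x, y)" by (cases c)
    have "c \<in> translate (- s 0, 0) P \<longleftrightarrow> (x + s 0, y) \<in> P"
      unfolding translate_def c by (force simp: image_iff)
    also have "\<dots> \<longleftrightarrow> c \<in> cells xs"
      using nth by (auto simp: c mem_cells len P stanley_cells_def)
    finally show "c \<in> cells xs \<longleftrightarrow> c \<in> translate (- s 0, 0) P" by simp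
  qed
  ultimately show ?thesis by (rule that)
qed

text \<open>Equal classes differ by a translation, which is zero between normalised lists;
  surjectivity is the normal form.\<close>

lemma bij_betw_cells_class:
  "bij_betw (\<lambda>xs. translation_rel `` {cells xs}) row_lists stanley_polyominoes"
  unfolding bij_betw_def
proof
  show "inj_on (\<lambda>xs. translation_rel `` {cells xs}) row_lists"
  proof (rule inj_onI)
    fix xs ys
    assume L: "xs \<in> row_lists" "ys \<in> row_lists"
      and "translation_rel `` {cells xs} = translation_rel `` {cells ys}"
    then have "(cells xs, cells ys) \<in> translation_rel"
      using eq_equiv_class[OF _ equiv_translation_rel] is_stanley_cells by blast
    then obtain v where v: "cells ys = translate v (cells xs)"
      by (auto simp: translation_rel_def)
    then have "v = 0"
      using L translate_cells_imp_zero by blast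
    with v have "cells xs = cells ys"
      by (simp add: translate_def)
    then show "xs = ys"
      using inj_cells by (simp add: inj_eq)
  qed
  show "(\<lambda>xs. translation_rel `` {cells xs}) ` row_lists = stanley_polyominoes"
  proof
    show "(\<lambda>xs. translation_rel `` {cells xs}) ` row_lists \<subseteq> stanley_polyominoes"
      unfolding stanley_polyominoes_def by (auto intro!: quotientI is_stanley_cells)
    show "stanley_polyominoes \<subseteq> (\<lambda>xs. translation_rel `` {cells xs}) ` row_lists"
    proof
      fix C assume "C \<in> stanley_polyominoes"
      then obtain P where P: "is_stanley P" "C = translation_rel `` {P}"
        by (auto simp: stanley_polyominoes_def elim: quotientE)
      then obtain xs v where xs: "xs \<in> row_lists" "cells xs = translate v P"
        using stanley_normal_form by blast
      then have "(P, cells xs) \<in> translation_rel"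
        using P is_stanley_cells[OF xs(1)] unfolding translation_rel_def by blast
      then have "C = translation_rel `` {cells xs}"
        using P equiv_class_eq[OF equiv_translation_rel] by simp
      then show "C \<in> (\<lambda>xs. translation_rel `` {cells xs}) ` row_lists"
        using xs(1) by blast
    qed
  qed
qed

lemma has_sum_stanley: "((\<lambda>P. fps_X ^ area P) has_sum rows_gf 0) stanley_polyominoes"
proof -
  have "((\<lambda>xs. fps_X ^ area (translation_rel `` {cells xs})) has_sum rows_gf 0) row_lists"
    using has_sum_gf[OF finite_fibres_row_lists]
    by (subst has_sum_cong[where g = "\<lambda>xs. fps_X ^ rows_area xs"])
       (simp_all add: rows_gf_def area_class is_stanley_cells card_cells)
  then show ?thesis
    by (subst (asm) has_sum_reindex_bij_betw[OF bij_betw_cells_class])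
qed


section \<open>Iterating the functional equation\<close>

abbreviation poch :: "nat \<Rightarrow> rat fps" where
  "poch \<equiv> q_pochhammer fps_X fps_X"

lemma poch_Suc: "poch (Suc l) = poch l * (1 - fps_X ^ Suc l)"
  by (simp add: q_pochhammer_def mult.commute)

lemma poch_nth_0: "poch l $ 0 = 1"
  by (induction l) (simp_all add: poch_Suc q_pochhammer_def del: power_Suc)

text \<open>Term \<open>l\<close> has order at least \<open>l\<close>, so coefficient
  \<open>n\<close> of the partial sums is constant once more than \<open>n\<close> terms are
  included.\<close>

lemma fps_suminf_nth:
  fixes f :: "nat \<Rightarrow> 'a::ab_group_add fps"
  assumes "\<And>l n. n < l \<Longrightarrow> f l $ n = 0" and "n < N"
  shows "suminf f $ n = (\<Sum>l<N. f l) $ n"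
proof -
  have trunc: "(\<Sum>l<M. f l $ m) = (\<Sum>l\<le>m. f l $ m)" if "m < M" for m M
    by (rule sum.mono_neutral_right) (use assms(1) that in auto)
  have "f sums Abs_fps (\<lambda>n. \<Sum>l\<le>n. f l $ n)"
    unfolding sums_def
  proof (rule tendsto_fpsI)
    fix m
    show "\<forall>\<^sub>F M in sequentially. (\<Sum>l<M. f l) $ m = Abs_fps (\<lambda>n. \<Sum>l\<le>n. f l $ n) $ m"
      using eventually_gt_at_top[of m] by eventually_elim (simp add: fps_sum_nth trunc)
  qed
  then have "suminf f = Abs_fps (\<lambda>n. \<Sum>l\<le>n. f l $ n)"
    by (rule sums_unique[symmetric])
  then show ?thesis
    using trunc[OF assms(2)] by (simp add: fps_sum_nth)
qed

definition num_term :: "nat \<Rightarrow> rat fps" where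
  "num_term l = (-1) ^ l * fps_X ^ ((l + 2) * (l + 1) div 2)
     / ((poch l)\<^sup>2 * (1 - fps_X ^ (l + 1)))"

definition den_term :: "nat \<Rightarrow> rat fps" where
  "den_term l = (-1) ^ l * fps_X ^ ((l + 4) * (l + 1) div 2) / (poch (l + 1))\<^sup>2"

text \<open>The denominator has constant term 1 and is a unit, so the quotient is a product with
  inverses and the iteration becomes ring algebra.\<close>

lemma num_term_eq:
  "num_term l = (-1) ^ l * fps_X ^ ((l + 2) * (l + 1) div 2)
     * ((inverse (poch l))\<^sup>2 * inverse (1 - fps_X ^ Suc l))"
  unfolding num_term_def
  by (subst fps_divide_unit)
     (simp_all add: poch_nth_0 fps_inverse_mult power2_eq_square)

lemma den_term_eq:
  "den_term l = (-1) ^ l * fps_X ^ ((l + 4) * (l + 1) div 2) * (inverse (poch (Suc l)))\<^sup>2"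
  unfolding den_term_def
  by (subst fps_divide_unit)
     (simp_all add: poch_nth_0 fps_inverse_mult power2_eq_square)

lemma sign_X_power_mult_nth:
  "n < m \<Longrightarrow> ((-1) ^ l * fps_X ^ m * f :: 'a::comm_ring_1 fps) $ n = 0"
  by (cases "even l") (simp_all add: fps_X_power_mult_nth)

lemma num_term_nth: "n \<le> l \<Longrightarrow> num_term l $ n = 0"
  unfolding num_term_eq by (rule sign_X_power_mult_nth) (auto simp: algebra_simps)

lemma den_term_nth: "n \<le> l \<Longrightarrow> den_term l $ n = 0"
  unfolding den_term_eq by (rule sign_X_power_mult_nth) (auto simp: algebra_simps)

text \<open>Each use of \<open>rows_gf_rec\<close> multiplies the remainder by
  \<open>- y / (1 - y)\<^sup>2\<close> with \<open>y = X ^ (i + 1)\<close>. Over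
  \<open>i < N\<close> these factors multiply to the sign, the triangular power of \<open>X\<close>
  and the inverse square of \<open>poch N\<close>.\<close>

lemma rows_gf_iterate:
  "rows_gf 0 = (\<Sum>l<N. num_term l) + rows_gf 0 * (\<Sum>l<N. den_term l)
     + (-1) ^ N * fps_X ^ (N * (N + 1) div 2) * ((inverse (poch N))\<^sup>2 * rows_gf N)"
proof (induction N)
  case 0
  then show ?case by (simp add: q_pochhammer_def)
next
  case (Suc N)
  define T where "T = N * (N + 1) div 2"
  define G where "G = (inverse (1 - fps_X ^ Suc N) :: rat fps)"
  define Q where "Q = inverse (poch N)"
  define y where "y = (fps_X ^ Suc N :: rat fps)"
  \<comment> \<open>\<open>T\<close> is the sum of 1 up to \<open>N\<close>. The inhomogeneous part
    adds one \<open>Suc N\<close> to the exponent, the part with \<open>rows_gf 0\<close> two, and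
    the next remainder one.\<close>
  have exps: "(N + 2) * (N + 1) div 2 = T + Suc N" "(N + 4) * (N + 1) div 2 = T + 2 * Suc N"
    "Suc N * (Suc N + 1) div 2 = T + Suc N"
    by (simp_all add: T_def algebra_simps)
  have pow: "fps_X ^ (T + Suc N) = fps_X ^ T * y" "fps_X ^ (T + 2 * Suc N) = fps_X ^ T * y\<^sup>2"
    by (simp_all only: y_def power_add power_even_eq)
  have Q: "inverse (poch (Suc N)) = Q * G"
    by (simp add: poch_Suc fps_inverse_mult Q_def G_def del: power_Suc)
  have rec: "rows_gf N = y * G + (y\<^sup>2 * rows_gf 0 - y * rows_gf (Suc N)) * G\<^sup>2"
    unfolding G_def y_def power_even_eq[symmetric] by (rule rows_gf_rec)
  have "rows_gf 0 = (\<Sum>l<N. num_term l) + rows_gf 0 * (\<Sum>l<N. den_term l)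
      + (-1) ^ N * fps_X ^ T * (Q\<^sup>2 * rows_gf N)"
    unfolding T_def Q_def by (rule Suc.IH)
  also have "(-1) ^ N * fps_X ^ T * (Q\<^sup>2 * rows_gf N) =
      num_term N + rows_gf 0 * den_term N
      + (-1) ^ Suc N * fps_X ^ (T + Suc N) * ((Q * G)\<^sup>2 * rows_gf (Suc N))"
    unfolding num_term_eq den_term_eq exps pow Q Q_def[symmetric] G_def[symmetric] rec
    by (simp add: algebra_simps)
  also have "(\<Sum>l<N. num_term l) + rows_gf 0 * (\<Sum>l<N. den_term l) + \<dots> =
      (\<Sum>l<Suc N. num_term l) + rows_gf 0 * (\<Sum>l<Suc N. den_term l)
      + (-1) ^ Suc N * fps_X ^ (T + Suc N) * ((Q * G)\<^sup>2 * rows_gf (Suc N))"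
    by (simp only: sum.lessThan_Suc distrib_left ac_simps)
  finally show ?case
    unfolding exps Q .
qed

theorem theorem2p9:
  shows "((\<lambda>P. (fps_X :: rat fps) ^ area P) has_sum
      ((\<Sum>l. (-1) ^ l * fps_X ^ ((l + 2) * (l + 1) div 2)
              / ((q_pochhammer fps_X fps_X l)\<^sup>2 * (1 - fps_X ^ (l + 1))))
       / (1 - (\<Sum>l. (-1) ^ l * fps_X ^ ((l + 4) * (l + 1) div 2)
                     / (q_pochhammer fps_X fps_X (l + 1))\<^sup>2))))
    stanley_polyominoes"
proof -
  have num: "suminf num_term $ n = (\<Sum>l<N. num_term l) $ n" if "n < N" for n N
    by (rule fps_suminf_nth) (use that num_term_nth in auto)
  have den: "suminf den_term $ n = (\<Sum>l<N. den_term l) $ n" if "n < N" for n N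
    by (rule fps_suminf_nth) (use that den_term_nth in auto)
  have "rows_gf 0 = suminf num_term + rows_gf 0 * suminf den_term"
  proof (rule fps_ext)
    fix n
    let ?N = "Suc n"
    \<comment> \<open>The remainder has order above \<open>n\<close>, so the unknown
      \<open>rows_gf ?N\<close> does not affect coefficient \<open>n\<close>.\<close>
    have "n < ?N * (?N + 1) div 2"
      by simp
    then have "rows_gf 0 $ n =
        (\<Sum>l<?N. num_term l) $ n + (rows_gf 0 * (\<Sum>l<?N. den_term l)) $ n"
      by (subst rows_gf_iterate[of ?N]) (simp only: fps_add_nth sign_X_power_mult_nth add_0_right)
    \<comment> \<open>The product at \<open>n\<close> involves only coefficients of the second
      factor up to \<open>n\<close>, where partial and infinite sum agree.\<close>
    also have "(rows_gf 0 * (\<Sum>l<?N. den_term l)) $ n = (rows_gf 0 * suminf den_term) $ n"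
      unfolding fps_mult_nth by (intro sum.cong refl) (simp add: den[of _ ?N])
    finally show "rows_gf 0 $ n = (suminf num_term + rows_gf 0 * suminf den_term) $ n"
      by (simp add: num[of n ?N])
  qed
  then have "suminf num_term = rows_gf 0 * (1 - suminf den_term)"
    by (simp add: algebra_simps)
  \<comment> \<open>So \<open>1 - suminf den_term\<close> has constant term 1 and can be divided
    by.\<close>
  moreover have "suminf den_term $ 0 = 0"
    using den[of 0 1] den_term_nth[of 0 0] by simp
  then have "1 - suminf den_term \<noteq> 0"
    by (metis diff_zero fps_nonzero_nth fps_one_nth fps_sub_nth zero_neq_one)
  ultimately have "rows_gf 0 = suminf num_term / (1 - suminf den_term)"
    by (simp add: fps_divide_times_eq)
  then show ?thesis
    using has_sum_stanley by (simp add: num_term_def[abs_def] den_term_def[abs_def])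
qed

end
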